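(* Let $\alpha=(\alpha_n)_{n\in\mathbb{N}}$ and $\beta=(\beta_n)_{n\in\mathbb{N}}$ be increasing sequences tending to infinity. The following statements are equivalent: (i) the pair $(\Lambda_\infty(\alpha),\Lambda_\infty(\beta))$ is tame; (ii) the pair $(\Lambda_\infty(\alpha),\Lambda_\infty(\beta))$ is linearly tame; (iii) the set $M_{\beta\alpha}$ of finite limit points of $(\beta_i/\alpha_j)_{i,j\in\mathbb{N}}$ is bounded.
   Context: For an increasing sequence $\alpha=(\alpha_n)$ tending to infinity, the power series space of infinite type is $\Lambda_\infty(\alpha)=\{x=(x_n):\ \|x\|_k=\sum_{n}|x_n|e^{k\alpha_n}<\infty\text{ for all }k\in\mathbb{N}\}$, a Fréchet space graded by the norms $\|\cdot\|_k$. For Fréchet spaces $E,F$ with increasing sequences of seminorms $(\|\cdot\|_k)$ and a continuous linear operator $T:E\to F$, put $\pi_T(k)=\inf\{r\in\mathbb{N}:\ \sup_{\|x\|_r\le1}\|Tx\|_k<\infty\}$. The pair $(E,F)$ is tame if there exists a non-decreasing function $S:\mathbb{N}\to\mathbb{N}$ such that for every continuous linear operator $T:E\to F$ one has $\pi_T(k)\le S(k)$ for all sufficiently large $k$. Equivalently, there is a sequence of increasing functions $S_a:\mathbb{N}\to\mathbb{N}$, $a\in\mathbb{N}$, such that for every continuous linear $T:E\to F$ there is an $a$ with $\pi_T(k)\le S_a(k)$ for all sufficiently large $k$. The pair $(E,F)$ is linearly tame if the latter holds with functions $S_a\nearrow S$, where $S$ is a linear function (of the form $k\mapsto ck+d$).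 A finite limit point of $(\beta_i/\alpha_j)_{i,j}$ is a real number every neighbourhood of which contains $\beta_i/\alpha_j$ for infinitely many pairs $(i,j)$. *)

theory Defs
  imports "HOL-Analysis.Analysis" "HOL-Library.Function_Algebras"
begin

text \<open>A vector space over \<open>'k\<close>, given as a subspace \<open>space_of\<close> of an ambient abelian group,
  graded by a sequence of seminorms.\<close>

record ('k, 'v) graded_space =
  space_of :: "'v set"
  scale_of :: "'k \<Rightarrow> 'v \<Rightarrow> 'v"
  seminorm_of :: "nat \<Rightarrow> 'v \<Rightarrow> real"

definition graded_topology :: "('k, 'v :: ab_group_add) graded_space \<Rightarrow> 'v topology" where
  "graded_topology E = topology_generated_by
     {{y \<in> space_of E. seminorm_of E k (y - x) < \<epsilon>} | k x \<epsilon>. x \<in> space_of E \<and> \<epsilon> > 0}"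

text \<open>Operators are total functions of which only the values on \<open>space_of E\<close> matter;
  \<open>continuous_map\<close> includes that \<open>space_of E\<close> is mapped into \<open>space_of F\<close>.\<close>

definition continuous_linear_operator ::
  "('k, 'v :: ab_group_add) graded_space \<Rightarrow> ('k, 'w :: ab_group_add) graded_space
    \<Rightarrow> ('v \<Rightarrow> 'w) \<Rightarrow> bool" where
  "continuous_linear_operator E F T \<longleftrightarrow>
     continuous_map (graded_topology E) (graded_topology F) T \<and>
     (\<forall>x\<in>space_of E. \<forall>y\<in>space_of E. T (x + y) = T x + T y) \<and>
     (\<forall>c. \<forall>x\<in>space_of E. T (scale_of E c x) = scale_of F c (T x))"

text \<open>For an operator that is continuous between spaces whose seminorms increase up to constant factors, the set below
  is nonempty, so the convention \<open>Inf {} = 0\<close> on \<open>nat\<close> does not come into play.\<close>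

definition continuity_index ::
  "('k, 'v) graded_space \<Rightarrow> ('k, 'w) graded_space \<Rightarrow> ('v \<Rightarrow> 'w) \<Rightarrow> nat \<Rightarrow> nat" where
  "continuity_index E F T k = Inf {r. bdd_above
     ((\<lambda>x. seminorm_of F k (T x)) ` {x \<in> space_of E. seminorm_of E r x \<le> 1})}"

definition tame_pair ::
  "('k, 'v :: ab_group_add) graded_space \<Rightarrow> ('k, 'w :: ab_group_add) graded_space \<Rightarrow> bool" where
  "tame_pair E F \<longleftrightarrow> (\<exists>S :: nat \<Rightarrow> nat. mono S \<and>
     (\<forall>T. continuous_linear_operator E F T \<longrightarrow>
        (\<forall>\<^sub>F k in sequentially. continuity_index E F T k \<le> S k)))"

text \<open>\<open>S\<^sub>a \<nearrow> S\<close> is read as: for each \<open>k\<close>, the sequence \<open>S\<^sub>a k\<close> is non-decreasing in \<open>a\<close> and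
  converges to \<open>S k = c * k + d\<close>.\<close>

definition linearly_tame_pair ::
  "('k, 'v :: ab_group_add) graded_space \<Rightarrow> ('k, 'w :: ab_group_add) graded_space \<Rightarrow> bool" where
  "linearly_tame_pair E F \<longleftrightarrow> (\<exists>(S :: nat \<Rightarrow> nat \<Rightarrow> nat) (c :: real) (d :: real).
     (\<forall>a. mono (S a)) \<and>
     (\<forall>k. mono (\<lambda>a. S a k) \<and> (\<lambda>a. real (S a k)) \<longlonglongrightarrow> c * real k + d) \<and>
     (\<forall>T. continuous_linear_operator E F T \<longrightarrow>
        (\<exists>a. \<forall>\<^sub>F k in sequentially. continuity_index E F T k \<le> S a k)))"

text \<open>The power series space of infinite type. The class \<open>real_normed_field\<close> covers both real
  and complex scalars.\<close>

definition power_series_space ::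
  "(nat \<Rightarrow> real) \<Rightarrow> ('k :: real_normed_field, nat \<Rightarrow> 'k) graded_space" where
  "power_series_space \<alpha> = \<lparr>
     space_of = {x. \<forall>k :: nat. summable (\<lambda>n. norm (x n) * exp (real k * \<alpha> n))},
     scale_of = (\<lambda>c x n. c * x n),
     seminorm_of = (\<lambda>k x. \<Sum>n. norm (x n) * exp (real k * \<alpha> n))\<rparr>"

text \<open>The finitely many indices \<open>j\<close> with \<open>\<alpha> j = 0\<close>, where the quotient is undefined, are left out.\<close>

definition finite_limit_points :: "(nat \<Rightarrow> real) \<Rightarrow> (nat \<Rightarrow> real) \<Rightarrow> real set" where
  "finite_limit_points \<beta> \<alpha> = {t. \<forall>U. open U \<longrightarrow> t \<in> U \<longrightarrow>
     infinite {(i, j). \<alpha> j \<noteq> 0 \<and> \<beta> i / \<alpha> j \<in> U}}"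

end

theory Submission imports Defs begin

text \<open>A continuous operator \<open>T\<close> satisfies \<open>\<parallel>T x\<parallel>\<^sub>k \<le> C \<parallel>x\<parallel>\<^sub>r\<close> as soon as it does so on the unit vectors
  \<open>e\<^sub>j\<close>, whose norms are \<open>exp (r \<alpha>\<^sub>j)\<close>.

  If all finite limit points lie below \<open>L\<close>, then by compactness of \<open>[L, K]\<close> almost every \<open>j\<close> has the
  property that each \<open>i\<close> satisfies \<open>\<beta>\<^sub>i \<le> L \<alpha>\<^sub>j\<close> or \<open>\<beta>\<^sub>i \<ge> K \<alpha>\<^sub>j\<close>. Hence
  \<open>\<parallel>T e\<^sub>j\<parallel>\<^sub>k \<le> exp (k L \<alpha>\<^sub>j) \<parallel>T e\<^sub>j\<parallel>\<^sub>0 + exp (- K \<alpha>\<^sub>j) \<parallel>T e\<^sub>j\<parallel>\<^sub>k\<^sub>+\<^sub>1\<close>, and continuity of \<open>T\<close> at the levels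
  \<open>0\<close> and \<open>k + 1\<close>, with \<open>K\<close> the index for level \<open>k + 1\<close>, bounds the continuity index at \<open>k\<close> by
  \<open>(L + 1) k\<close> once \<open>k\<close> is at least the index for level \<open>0\<close>.

  If the limit points are unbounded and \<open>S\<close> is given, choose for each \<open>m\<close> infinitely many pairs \<open>(i, j)\<close>
  with \<open>\<beta>\<^sub>i / \<alpha>\<^sub>j\<close> above \<open>S (m + 1) + 1\<close> and below some \<open>B m\<close>, no index being used twice, and put
  \<open>T e\<^sub>j = exp (- m \<beta>\<^sub>i) e\<^sub>i\<close>. The factor makes the \<open>m\<close>-th family harmless for the levels \<open>k \<le> m\<close>,
  so that \<open>T\<close> is continuous, while this family forces the index at \<open>m + 1\<close> above \<open>S (m + 1)\<close>.\<close>

section \<open>Seminorms of power series spaces\<close>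

lemma power_series_space_simps [simp]:
  "x \<in> space_of (power_series_space \<alpha>) \<longleftrightarrow> (\<forall>k::nat. summable (\<lambda>n. norm (x n) * exp (real k * \<alpha> n)))"
  "scale_of (power_series_space \<alpha>) = (\<lambda>c x n. c * x n)"
  "seminorm_of (power_series_space \<alpha>) k x = (\<Sum>n. norm (x n) * exp (real k * \<alpha> n))"
  by (auto simp: power_series_space_def)

lemma summable_seminorm_add:
  fixes x y :: "nat \<Rightarrow> 'k::real_normed_field"
  assumes "summable (\<lambda>n. norm (x n) * w n)" "summable (\<lambda>n. norm (y n) * w n)" "\<And>n. w n \<ge> (0::real)"
  shows "summable (\<lambda>n. norm ((x + y) n) * w n)"
    and "(\<Sum>n. norm ((x + y) n) * w n) \<le> (\<Sum>n. norm (x n) * w n) + (\<Sum>n. norm (y n) * w n)"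
proof -
  have sm: "summable (\<lambda>n. norm (x n) * w n + norm (y n) * w n)"
    using assms(1,2) by (rule summable_add)
  have le: "norm ((x + y) n) * w n \<le> norm (x n) * w n + norm (y n) * w n" for n
    using mult_right_mono[OF norm_triangle_ineq[of "x n" "y n"] assms(3)[of n]]
    by (simp add: distrib_right)
  show s: "summable (\<lambda>n. norm ((x + y) n) * w n)"
    by (rule summable_comparison_test'[OF sm, of 0]) (use le assms(3) in auto)
  show "(\<Sum>n. norm ((x + y) n) * w n) \<le> (\<Sum>n. norm (x n) * w n) + (\<Sum>n. norm (y n) * w n)"
    unfolding suminf_add[OF assms(1,2)] using le s sm by (intro suminf_le) auto
qed

lemma seminorm_nonneg:
  "x \<in> space_of (power_series_space \<alpha>) \<Longrightarrow> 0 \<le> seminorm_of (power_series_space \<alpha>) k x"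
  by (auto intro!: suminf_nonneg)

lemma seminorm_uminus:
  "seminorm_of (power_series_space \<alpha>) k (- x) = seminorm_of (power_series_space \<alpha>) k x"
  "- x \<in> space_of (power_series_space \<alpha>) \<longleftrightarrow> x \<in> space_of (power_series_space \<alpha>)"
  by (auto simp: fun_Compl_def)

lemma seminorm_add:
  assumes "x \<in> space_of (power_series_space \<alpha>)" "y \<in> space_of (power_series_space \<alpha>)"
  shows "x + y \<in> space_of (power_series_space \<alpha>)"
    and "seminorm_of (power_series_space \<alpha>) k (x + y)
      \<le> seminorm_of (power_series_space \<alpha>) k x + seminorm_of (power_series_space \<alpha>) k y"
proof -
  show "x + y \<in> space_of (power_series_space \<alpha>)"
    using assms unfolding power_series_space_simps
    by (intro allI summable_seminorm_add(1)) auto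
  show "seminorm_of (power_series_space \<alpha>) k (x + y)
      \<le> seminorm_of (power_series_space \<alpha>) k x + seminorm_of (power_series_space \<alpha>) k y"
    using assms unfolding power_series_space_simps
    by (intro summable_seminorm_add(2)) auto
qed

lemma seminorm_diff:
  assumes "x \<in> space_of (power_series_space \<alpha>)" "y \<in> space_of (power_series_space \<alpha>)"
  shows "x - y \<in> space_of (power_series_space \<alpha>)"
    and "seminorm_of (power_series_space \<alpha>) k (x - y)
      \<le> seminorm_of (power_series_space \<alpha>) k x + seminorm_of (power_series_space \<alpha>) k y"
  using seminorm_add[OF assms(1), of "- y"] assms(2)
  unfolding seminorm_uminus add_uminus_conv_diff by blast+

lemma seminorm_scale:
  assumes "x \<in> space_of (power_series_space \<alpha>)"
  shows "(\<lambda>n. c * x n) \<in> space_of (power_series_space \<alpha>)"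
    and "seminorm_of (power_series_space \<alpha>) k (\<lambda>n. c * x n)
      = norm c * seminorm_of (power_series_space \<alpha>) k x"
  using assms by (auto simp: norm_mult mult.assoc intro: summable_mult suminf_mult)

lemma seminorm_zero:
  "0 \<in> space_of (power_series_space \<alpha>)" "seminorm_of (power_series_space \<alpha>) k 0 = 0"
  by auto

text \<open>For \<open>k \<le> r\<close> the factor \<open>k - r\<close> is nonpositive, so
  \<open>(k - r) * \<alpha> n\<close> is largest at \<open>n = 0\<close>. The constant can exceed 1
  because early terms of \<alpha> may be negative.\<close>

lemma seminorm_le_higher:
  assumes "mono \<alpha>" "k \<le> r" "x \<in> space_of (power_series_space \<alpha>)"
  shows "seminorm_of (power_series_space \<alpha>) k x
    \<le> exp ((real k - real r) * \<alpha> 0) * seminorm_of (power_series_space \<alpha>) r x"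
proof -
  have sm: "summable (\<lambda>n. norm (x n) * exp (real k * \<alpha> n))" "summable (\<lambda>n. norm (x n) * exp (real r * \<alpha> n))"
    using assms(3) by auto
  have "norm (x n) * exp (real k * \<alpha> n)
      \<le> exp ((real k - real r) * \<alpha> 0) * (norm (x n) * exp (real r * \<alpha> n))" for n
  proof -
    have "(real k - real r) * \<alpha> n \<le> (real k - real r) * \<alpha> 0"
      using assms(1,2) by (intro mult_left_mono_neg) (auto simp: mono_def)
    then have "exp (real k * \<alpha> n) \<le> exp ((real k - real r) * \<alpha> 0) * exp (real r * \<alpha> n)"
      by (simp flip: exp_add add: algebra_simps)
    then show ?thesis
      by (metis mult.left_commute mult_left_mono norm_ge_zero)
  qed
  then show ?thesis
    using sm by (auto simp flip: suminf_mult intro!: suminf_le summable_mult)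
qed

section \<open>The graded topology and continuity of linear operators\<close>

lemma topspace_graded_topology:
  assumes "\<And>k. seminorm_of E k 0 = 0"
  shows "topspace (graded_topology E) = space_of E"
proof -
  have "x \<in> \<Union> {{y \<in> space_of E. seminorm_of E k (y - x) < \<epsilon>} | k x \<epsilon>. x \<in> space_of E \<and> \<epsilon> > 0}"
    if x: "x \<in> space_of E" for x
  proof (rule UnionI)
    show "{y \<in> space_of E. seminorm_of E 0 (y - x) < 1}
        \<in> {{y \<in> space_of E. seminorm_of E k (y - x) < \<epsilon>} | k x \<epsilon>. x \<in> space_of E \<and> \<epsilon> > 0}"
      using x zero_less_one by blast
  qed (use x assms in simp)
  then show ?thesis
    unfolding graded_topology_def topology_generated_by_topspace by blast
qed

lemma topspace_power_series_space:
  "topspace (graded_topology (power_series_space \<alpha>)) = space_of (power_series_space \<alpha>)"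
  by (rule topspace_graded_topology) simp

lemma openin_graded_ball:
  assumes "x \<in> space_of E" "\<epsilon> > 0"
  shows "openin (graded_topology E) {y \<in> space_of E. seminorm_of E k (y - x) < \<epsilon>}"
  unfolding graded_topology_def by (rule topology_generated_by_Basis) (use assms in blast)

text \<open>The balls of the definition are only a subbasis. Any two seminorms are dominated, up to
  constants, by one of higher level, so finite intersections of balls still contain a ball around
  each of their points. The proof follows the generation of the topology.\<close>

lemma openin_power_series_space_ball:
  fixes \<alpha> :: "nat \<Rightarrow> real" and U :: "(nat \<Rightarrow> 'k::real_normed_field) set"
  defines "E \<equiv> power_series_space \<alpha> :: ('k, nat \<Rightarrow> 'k) graded_space"
  assumes "mono \<alpha>" "openin (graded_topology E) U" "x \<in> U"
  shows "\<exists>k \<delta>. \<delta> > 0 \<and> {y \<in> space_of E. seminorm_of E k (y - x) < \<delta>} \<subseteq> U"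
proof -
  have "generate_topology_on
     {{y \<in> space_of E. seminorm_of E k (y - x) < \<epsilon>} | k x \<epsilon>. x \<in> space_of E \<and> \<epsilon> > 0} U"
    using assms(3) by (simp add: graded_topology_def openin_topology_generated_by_iff)
  then show ?thesis using \<open>x \<in> U\<close>
  proof (induction arbitrary: x)
    case Empty
    then show ?case by simp
  next
    case (Int A B)
    obtain k \<delta> where A: "\<delta> > 0" "{y \<in> space_of E. seminorm_of E k (y - x) < \<delta>} \<subseteq> A"
      using Int by blast
    obtain l \<eta> where B: "\<eta> > 0" "{y \<in> space_of E. seminorm_of E l (y - x) < \<eta>} \<subseteq> B"
      using Int by blast
    define r where "r = max k l"
    define c where "c = exp ((real k - real r) * \<alpha> 0)"
    define d where "d = exp ((real l - real r) * \<alpha> 0)"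
    have pos: "c > 0" "d > 0" by (auto simp: c_def d_def)
    \<comment> \<open>The induction provides only \<open>x \<in> A\<close>; membership in the space
      follows because open sets lie in the topspace.\<close>
    have "x \<in> space_of E"
    proof -
      have "openin (graded_topology E) A"
        unfolding graded_topology_def openin_topology_generated_by_iff by (rule Int.hyps(1))
      then have "x \<in> topspace (graded_topology E)"
        using Int.prems openin_subset by blast
      then show ?thesis
        unfolding E_def topspace_power_series_space .
    qed
    then have "seminorm_of E k (y - x) \<le> c * seminorm_of E r (y - x)"
       "seminorm_of E l (y - x) \<le> d * seminorm_of E r (y - x)" if "y \<in> space_of E" for y
      using that assms(2) seminorm_diff(1)[of y \<alpha> x] unfolding E_def c_def d_def
      by (auto simp: r_def simp del: power_series_space_simps intro!: seminorm_le_higher)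
    then have "{y \<in> space_of E. seminorm_of E r (y - x) < min (\<delta> / c) (\<eta> / d)} \<subseteq> A \<inter> B"
      using A(2) B(2) pos by (fastforce simp: field_simps)
    moreover have "min (\<delta> / c) (\<eta> / d) > 0" using A B pos by simp
    ultimately show ?case by blast
  next
    case (UN K)
    then show ?case by blast
  next
    case (Basis s)
    then obtain k z \<epsilon> where s: "s = {y \<in> space_of E. seminorm_of E k (y - z) < \<epsilon>}"
      "z \<in> space_of E" "\<epsilon> > 0" by blast
    \<comment> \<open>Balls of the subbasis are centred at an arbitrary \<open>z\<close>; the
      triangle inequality recentres them at \<open>x\<close> with a smaller radius.\<close>
    have "seminorm_of E k (y - z) \<le> seminorm_of E k (y - x) + seminorm_of E k (x - z)"
      if "y \<in> space_of E" for y
      using seminorm_add(2)[OF seminorm_diff(1) seminorm_diff(1), of y \<alpha> x x z k]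
        that Basis.prems s unfolding E_def diff_add_cancel add_diff_eq by blast
    then have "{y \<in> space_of E. seminorm_of E k (y - x) < \<epsilon> - seminorm_of E k (x - z)} \<subseteq> s"
      using s by fastforce
    moreover have "\<epsilon> - seminorm_of E k (x - z) > 0" using Basis.prems s by simp
    ultimately show ?case by blast
  qed
qed

lemma continuous_linear_operatorD:
  assumes "continuous_linear_operator (power_series_space \<alpha>) (power_series_space \<beta>) T"
    and "x \<in> space_of (power_series_space \<alpha>)"
  shows "T x \<in> space_of (power_series_space \<beta>)"
    and "y \<in> space_of (power_series_space \<alpha>) \<Longrightarrow> T (x + y) = T x + T y"
    and "T (\<lambda>n. c * x n) = (\<lambda>n. c * T x n)"
proof -
  have "T ` space_of (power_series_space \<alpha>) \<subseteq> space_of (power_series_space \<beta>)"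
    using assms(1) continuous_map_image_subset_topspace
    unfolding continuous_linear_operator_def topspace_power_series_space[symmetric] by blast
  then show "T x \<in> space_of (power_series_space \<beta>)" using assms(2) by blast
qed (use assms in \<open>simp_all add: continuous_linear_operator_def\<close>)

text \<open>The preimage of the open unit ball of level \<open>k\<close> is a neighbourhood of 0 and
  contains a ball of radius \<delta> at some level \<open>r\<close>. Homogeneity then yields the
  constant \<open>1 / \<delta>\<close>.\<close>

lemma continuous_linear_operator_bound:
  fixes \<alpha> \<beta> :: "nat \<Rightarrow> real" and T :: "(nat \<Rightarrow> 'k::real_normed_field) \<Rightarrow> nat \<Rightarrow> 'k"
  defines "E \<equiv> power_series_space \<alpha> :: ('k, nat \<Rightarrow> 'k) graded_space"
    and "F \<equiv> power_series_space \<beta> :: ('k, nat \<Rightarrow> 'k) graded_space"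
  assumes "mono \<alpha>" and T: "continuous_linear_operator E F T"
  shows "\<exists>r C. C \<ge> 0 \<and> (\<forall>x\<in>space_of E. seminorm_of F k (T x) \<le> C * seminorm_of E r x)"
proof -
  have top: "topspace (graded_topology E) = space_of E" "topspace (graded_topology F) = space_of F"
    unfolding E_def F_def by (rule topspace_power_series_space)+
  have z: "0 \<in> space_of E" "0 \<in> space_of F" unfolding E_def F_def by simp_all
  have cont: "continuous_map (graded_topology E) (graded_topology F) T"
    using T by (simp add: continuous_linear_operator_def)
  note T_in = continuous_linear_operatorD(1)[OF T[unfolded E_def F_def], folded E_def F_def]
    and add = continuous_linear_operatorD(2)[OF T[unfolded E_def F_def], folded E_def F_def]
    and sc = continuous_linear_operatorD(3)[OF T[unfolded E_def F_def], folded E_def F_def]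
  have T0: "T 0 = 0" using add[OF z(1) z(1)] by simp
  define U where "U = {x \<in> topspace (graded_topology E). T x \<in> {y \<in> space_of F. seminorm_of F k (y - 0) < 1}}"
  have "openin (graded_topology E) U"
    unfolding U_def by (rule openin_continuous_map_preimage[OF cont openin_graded_ball]) (use z in auto)
  moreover have "0 \<in> U" using z T0 unfolding U_def top by (simp add: F_def)
  ultimately obtain r \<delta> where r: "\<delta> > 0" "{x \<in> space_of E. seminorm_of E r (x - 0) < \<delta>} \<subseteq> U"
    using openin_power_series_space_ball[OF \<open>mono \<alpha>\<close>] unfolding E_def by blast
  have "seminorm_of F k (T x) \<le> 1 / \<delta> * seminorm_of E r x" if x: "x \<in> space_of E" for x
  proof -
    let ?s = "seminorm_of E r x"
    have s0: "?s \<ge> 0" using x unfolding E_def by (rule seminorm_nonneg)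
    \<comment> \<open>The added \<epsilon> keeps the scaling factor \<open>c\<close> defined when
      the seminorm of \<open>x\<close> vanishes and puts the multiple of \<open>x\<close> strictly
      inside the open ball.\<close>
    have "\<delta> * seminorm_of F k (T x) \<le> ?s + \<epsilon>" if "\<epsilon> > 0" for \<epsilon>
    proof -
      define c where "c = \<delta> / (?s + \<epsilon>)"
      have c: "c > 0" using r that s0 by (simp add: c_def)
      have "c * ?s < \<delta>" using r that s0 by (simp add: c_def field_simps)
      then have "seminorm_of E r (\<lambda>n. of_real c * x n) < \<delta>"
        using x c unfolding E_def by (subst seminorm_scale(2)) auto
      then have "(\<lambda>n. of_real c * x n) \<in> U"
        using r(2) seminorm_scale(1)[of x \<alpha>] x unfolding E_def by auto
      then have "seminorm_of F k (\<lambda>n. of_real c * T x n) < 1"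
        unfolding U_def using sc[OF x, of "of_real c"] by simp
      then have "c * seminorm_of F k (T x) < 1"
        using T_in[OF x] c unfolding F_def by (subst (asm) seminorm_scale(2)) auto
      then show ?thesis using that s0 unfolding c_def by (simp add: field_simps)
    qed
    then have "\<delta> * seminorm_of F k (T x) \<le> ?s" by (rule field_le_epsilon)
    then show ?thesis using r by (simp add: field_simps)
  qed
  moreover have "1 / \<delta> \<ge> 0" using r by simp
  ultimately show ?thesis by blast
qed

text \<open>Preimages need to be checked only for the generating balls. Around each point of such a
  preimage the estimate \<open>bd\<close>, applied to the difference \<open>y - x\<close>, provides
  a ball inside it.\<close>

lemma continuous_linear_operatorI:
  fixes \<alpha> \<beta> :: "nat \<Rightarrow> real" and T :: "(nat \<Rightarrow> 'k::real_normed_field) \<Rightarrow> nat \<Rightarrow> 'k"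
  defines "E \<equiv> power_series_space \<alpha> :: ('k, nat \<Rightarrow> 'k) graded_space"
    and "F \<equiv> power_series_space \<beta> :: ('k, nat \<Rightarrow> 'k) graded_space"
  assumes add: "\<And>x y. x \<in> space_of E \<Longrightarrow> y \<in> space_of E \<Longrightarrow> T (x + y) = T x + T y"
    and sc: "\<And>c x. x \<in> space_of E \<Longrightarrow> T (scale_of E c x) = scale_of F c (T x)"
    and T_in: "\<And>x. x \<in> space_of E \<Longrightarrow> T x \<in> space_of F"
    and bd: "\<And>k. \<exists>r C. \<forall>x\<in>space_of E. seminorm_of F k (T x) \<le> C * seminorm_of E r x"
  shows "continuous_linear_operator E F T"
proof -
  have top: "topspace (graded_topology E) = space_of E" "topspace (graded_topology F) = space_of F"
    unfolding E_def F_def by (rule topspace_power_series_space)+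
  have diff: "T (x - y) = T x - T y" if "x \<in> space_of E" "y \<in> space_of E" for x y
    using add[of "x - y" y] that seminorm_diff(1)[of x \<alpha> y] unfolding E_def by simp
  have "openin (graded_topology E) (T -` V \<inter> topspace (graded_topology E))"
    if V: "V = {y \<in> space_of F. seminorm_of F k (y - z) < \<epsilon>}" "z \<in> space_of F" for V k z \<epsilon>
  proof (subst openin_subopen, intro ballI)
    fix x assume "x \<in> T -` V \<inter> topspace (graded_topology E)"
    then have x: "x \<in> space_of E" "seminorm_of F k (T x - z) < \<epsilon>" using V top by auto
    obtain r C where C: "\<And>x. x \<in> space_of E \<Longrightarrow> seminorm_of F k (T x) \<le> C * seminorm_of E r x"
      using bd by blast
    \<comment> \<open>\<open>bd\<close> says nothing about the sign of \<open>C\<close>;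
      \<open>\<bar>C\<bar> + 1\<close> dominates it and is positive, so division is safe.\<close>
    define \<delta> where "\<delta> = (\<epsilon> - seminorm_of F k (T x - z)) / (\<bar>C\<bar> + 1)"
    have \<delta>: "\<delta> > 0" using x by (simp add: \<delta>_def)
    let ?B = "{y \<in> space_of E. seminorm_of E r (y - x) < \<delta>}"
    have "T y \<in> V" if y: "y \<in> space_of E" "seminorm_of E r (y - x) < \<delta>" for y
    proof -
      have yx: "y - x \<in> space_of E" using y x seminorm_diff(1) unfolding E_def by blast
      have "seminorm_of F k (T y - z) \<le> seminorm_of F k (T y - T x) + seminorm_of F k (T x - z)"
        using seminorm_add(2)[OF seminorm_diff(1) seminorm_diff(1), of "T y" \<beta> "T x" "T x" z k]
          T_in[OF x(1)] T_in[OF y(1)] V(2) unfolding F_def diff_add_cancel add_diff_eq by blast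
      moreover have "seminorm_of F k (T y - T x) \<le> (\<bar>C\<bar> + 1) * seminorm_of E r (y - x)"
      proof -
        have "seminorm_of F k (T y - T x) \<le> C * seminorm_of E r (y - x)"
          using C[OF yx] diff x y by simp
        also have "\<dots> \<le> (\<bar>C\<bar> + 1) * seminorm_of E r (y - x)"
          using seminorm_nonneg[of "y - x" \<alpha> r] yx unfolding E_def by (intro mult_right_mono) auto
        finally show ?thesis .
      qed
      moreover have "(\<bar>C\<bar> + 1) * seminorm_of E r (y - x) < (\<bar>C\<bar> + 1) * \<delta>"
        using y by (intro mult_strict_left_mono) auto
      moreover have "(\<bar>C\<bar> + 1) * \<delta> = \<epsilon> - seminorm_of F k (T x - z)"
        unfolding \<delta>_def by (simp add: add_nonneg_eq_0_iff)
      ultimately show ?thesis using V T_in y by simp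
    qed
    then have "?B \<subseteq> T -` V \<inter> topspace (graded_topology E)" using top by auto
    moreover have "x \<in> ?B" using x \<delta> by (simp add: E_def)
    ultimately show "\<exists>B. openin (graded_topology E) B \<and> x \<in> B \<and> B \<subseteq> T -` V \<inter> topspace (graded_topology E)"
      using openin_graded_ball[OF x(1) \<delta>] by blast
  qed
  moreover have "T ` topspace (graded_topology E) \<subseteq> topspace (graded_topology F)"
    using T_in top by auto
  ultimately have "continuous_map (graded_topology E) (graded_topology F) T"
    unfolding graded_topology_def[of F] topology_generated_by_topspace
    by (intro continuous_on_generated_topo) blast+
  then show ?thesis
    unfolding continuous_linear_operator_def using add sc by blast
qed

section \<open>Unit vectors and the continuity index\<close>

lemma single_in_power_series_space:
  fixes c :: "'k::real_normed_field"
  shows "(\<lambda>n. if n = j then c else 0) \<in> space_of (power_series_space \<alpha>)"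
    and "seminorm_of (power_series_space \<alpha>) k (\<lambda>n. if n = j then c else 0) = norm c * exp (real k * \<alpha> j)"
proof -
  have "(\<lambda>n. norm (if n = j then c else 0) * exp (real k * \<alpha> n)) sums (norm c * exp (real k * \<alpha> j))" for k :: nat
    using sums_single[of j "\<lambda>n. norm c * exp (real k * \<alpha> n)"]
    by (rule back_subst[where P = "\<lambda>f. f sums _"]) auto
  then show "(\<lambda>n. if n = j then c else 0) \<in> space_of (power_series_space \<alpha>)"
    "seminorm_of (power_series_space \<alpha>) k (\<lambda>n. if n = j then c else 0) = norm c * exp (real k * \<alpha> j)"
    by (auto simp: sums_iff)
qed

lemma truncation_approximates:
  fixes x :: "nat \<Rightarrow> 'k::real_normed_field"
  assumes "x \<in> space_of (power_series_space \<alpha>)" "\<epsilon> > 0"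
  shows "\<exists>N. x - (\<lambda>n. if n < N then x n else 0) \<in> space_of (power_series_space \<alpha>) \<and>
    seminorm_of (power_series_space \<alpha>) s (x - (\<lambda>n. if n < N then x n else 0)) < \<epsilon>"
proof -
  let ?f = "\<lambda>s n. norm (x n) * exp (real s * \<alpha> n)"
  let ?y = "\<lambda>N. x - (\<lambda>n. if n < N then x n else 0)"
  have sm: "summable (?f s)" for s using assms by simp
  then obtain N where N: "norm (\<Sum>i. ?f s (i + N)) < \<epsilon>"
    using suminf_exist_split[OF assms(2)] by blast
  have sy: "summable (\<lambda>n. norm (?y N n) * exp (real s * \<alpha> n))" for s :: nat
    by (rule summable_comparison_test'[OF sm[of s], of 0]) auto
  have "(\<Sum>n. norm (?y N n) * exp (real s * \<alpha> n)) = (\<Sum>i. ?f s (i + N))"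
    using suminf_split_initial_segment[OF sy[of s], of N] by simp
  then show ?thesis using N sy by (intro exI[of _ N]) auto
qed

text \<open>The seminorms are weighted l1 norms, so on finite combinations of unit vectors the bound
  follows from the triangle inequality. Truncations approximate every \<open>x\<close>, and
  continuity of \<open>T\<close> carries the bound over.\<close>

lemma continuity_index_le:
  fixes T :: "(nat \<Rightarrow> 'k::real_normed_field) \<Rightarrow> nat \<Rightarrow> 'k" and \<alpha> \<beta> :: "nat \<Rightarrow> real"
  defines "E \<equiv> power_series_space \<alpha> :: ('k, nat \<Rightarrow> 'k) graded_space"
    and "F \<equiv> power_series_space \<beta> :: ('k, nat \<Rightarrow> 'k) graded_space"
  assumes "mono \<alpha>" and T: "continuous_linear_operator E F T" and C: "C \<ge> 0"
    and bd: "\<And>j. seminorm_of F k (T (\<lambda>n. if n = j then 1 else 0)) \<le> C * exp (real r * \<alpha> j)"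
  shows "continuity_index E F T k \<le> r"
proof -
  note T_in = continuous_linear_operatorD(1)[OF T[unfolded E_def F_def], folded E_def F_def]
    and add = continuous_linear_operatorD(2)[OF T[unfolded E_def F_def], folded E_def F_def]
    and sc = continuous_linear_operatorD(3)[OF T[unfolded E_def F_def], folded E_def F_def]
  have z: "0 \<in> space_of E" unfolding E_def by simp
  have T0: "T 0 = 0" using add[OF z z] by simp
  have "seminorm_of F k (T x) \<le> C * seminorm_of E r x" if x: "x \<in> space_of E" for x
  proof -
    define P where "P = (\<lambda>N n. if n < N then x n else 0)"
    let ?e = "\<lambda>j n. if n = j then 1 else (0::'k)"
    have sm: "summable (\<lambda>n. norm (x n) * exp (real r * \<alpha> n))" using x by (simp add: E_def)
    have P: "P N \<in> space_of E \<and> seminorm_of F k (T (P N)) \<le> C * (\<Sum>n<N. norm (x n) * exp (real r * \<alpha> n))" for N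
    proof (induction N)
      case 0
      have P0: "P 0 = 0" by (auto simp: P_def)
      have "seminorm_of F k (T (P 0)) = 0"
        unfolding P0 T0 F_def by (rule seminorm_zero)
      then show ?case using z unfolding P0 by (metis lessThan_0 mult_zero_right order_refl sum.empty)
    next
      case (Suc N)
      have e: "?e N \<in> space_of E" unfolding E_def by (rule single_in_power_series_space)
      have xe: "(\<lambda>n. x N * ?e N n) \<in> space_of E"
        using e unfolding E_def by (rule seminorm_scale(1))
      have split: "P (Suc N) = P N + (\<lambda>n. x N * ?e N n)"
        by (auto simp: P_def fun_eq_iff less_Suc_eq)
      have "T (P (Suc N)) = T (P N) + (\<lambda>n. x N * T (?e N) n)"
        using split add[OF _ xe] sc[OF e] Suc by simp
      then have "seminorm_of F k (T (P (Suc N)))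
          \<le> seminorm_of F k (T (P N)) + seminorm_of F k (\<lambda>n. x N * T (?e N) n)"
        using seminorm_add(2)[OF _ seminorm_scale(1), of "T (P N)" \<beta> "T (?e N)" k "x N"] T_in e Suc
        unfolding F_def by (simp del: power_series_space_simps)
      also have "seminorm_of F k (\<lambda>n. x N * T (?e N) n) = norm (x N) * seminorm_of F k (T (?e N))"
        using T_in[OF e] unfolding F_def by (rule seminorm_scale(2))
      also have "\<dots> \<le> norm (x N) * (C * exp (real r * \<alpha> N))"
        using bd by (intro mult_left_mono) auto
      also have "seminorm_of F k (T (P N)) \<le> C * (\<Sum>n<N. norm (x n) * exp (real r * \<alpha> n))"
        using Suc by simp
      finally have "seminorm_of F k (T (P (Suc N))) \<le> C * (\<Sum>n<Suc N. norm (x n) * exp (real r * \<alpha> n))"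
        by (simp add: algebra_simps)
      moreover have "P (Suc N) \<in> space_of E"
        using seminorm_add(1)[of "P N" \<alpha>] Suc xe split unfolding E_def by simp
      ultimately show ?case by blast
    qed
    \<comment> \<open>The level \<open>s\<close> supplied by continuity may be much larger than
      \<open>r\<close>. It serves only to make the image of the remainder small and leaves no trace
      in the final bound.\<close>
    obtain s C' where C': "C' \<ge> 0" "\<And>x. x \<in> space_of E \<Longrightarrow> seminorm_of F k (T x) \<le> C' * seminorm_of E s x"
      using continuous_linear_operator_bound[OF \<open>mono \<alpha>\<close>] T unfolding E_def F_def by blast
    show ?thesis
    proof (rule field_le_epsilon)
      fix \<epsilon> :: real assume \<epsilon>: "\<epsilon> > 0"
      then have "\<epsilon> / (C' + 1) > 0" using C' by simp
      from truncation_approximates[OF _ this] x obtain N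
        where N: "x - P N \<in> space_of E" "seminorm_of E s (x - P N) < \<epsilon> / (C' + 1)"
        unfolding E_def P_def by blast
      have "C' * seminorm_of E s (x - P N) \<le> C' * (\<epsilon> / (C' + 1))"
        using N C' by (intro mult_left_mono) auto
      also have "\<dots> \<le> \<epsilon>" using C' \<epsilon> by (simp add: field_simps)
      finally have small: "seminorm_of F k (T (x - P N)) \<le> \<epsilon>" using C'(2)[OF N(1)] by linarith
      have "T x = T (P N) + T (x - P N)" using add[of "P N" "x - P N"] P N by simp
      then have "seminorm_of F k (T x) \<le> seminorm_of F k (T (P N)) + seminorm_of F k (T (x - P N))"
        using seminorm_add(2)[of "T (P N)" \<beta> "T (x - P N)" k] T_in P N
        unfolding F_def by (simp del: power_series_space_simps)
      also have "seminorm_of F k (T (P N)) \<le> C * seminorm_of E r x"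
      proof -
        have "(\<Sum>n<N. norm (x n) * exp (real r * \<alpha> n)) \<le> seminorm_of E r x"
          using sm by (auto simp: E_def intro!: sum_le_suminf)
        then show ?thesis using P[of N] C by (meson mult_left_mono order_trans)
      qed
      finally show "seminorm_of F k (T x) \<le> C * seminorm_of E r x + \<epsilon>" using small by linarith
    qed
  qed
  then have "seminorm_of F k (T x) \<le> C" if "x \<in> space_of E" "seminorm_of E r x \<le> 1" for x
    using that C by (meson mult_left_le order_trans)
  then have "bdd_above ((\<lambda>x. seminorm_of F k (T x)) ` {x \<in> space_of E. seminorm_of E r x \<le> 1})"
    by (intro bdd_aboveI[of _ C]) auto
  then show ?thesis
    unfolding continuity_index_def by (intro cInf_lower) auto
qed

section \<open>Linear tameness implies tameness\<close>

lemma linearly_tame_imp_tame_pair: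
  assumes "linearly_tame_pair E F"
  shows "tame_pair E F"
proof -
  obtain S :: "nat \<Rightarrow> nat \<Rightarrow> nat" and c d :: real
    where S: "\<And>a. mono (S a)" "\<And>k. mono (\<lambda>a. S a k)"
      "\<And>k. (\<lambda>a. real (S a k)) \<longlonglongrightarrow> c * real k + d"
      and T: "\<And>T. continuous_linear_operator E F T \<Longrightarrow>
        \<exists>a. \<forall>\<^sub>F k in sequentially. continuity_index E F T k \<le> S a k"
    using assms unfolding linearly_tame_pair_def by blast
  \<comment> \<open>The integers \<open>S a k\<close> increase to the limit in \<open>a\<close>,
    hence lie below its floor. The limit is nonnegative, so \<open>nat\<close> loses
    nothing.\<close>
  define R where "R k = nat \<lfloor>c * real k + d\<rfloor>" for k
  have "c * real k + d \<le> c * real l + d" if "k \<le> l" for k l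
    using S(3)[of k] S(3)[of l] by (rule LIMSEQ_le) (use S(1) that in \<open>auto simp: mono_def\<close>)
  then have "mono R"
    unfolding R_def by (intro monoI nat_mono floor_mono) auto
  moreover have le: "S a k \<le> R k" for a k
  proof -
    have "real (S a k) \<le> c * real k + d"
      using S(3) by (rule incseq_le[rotated]) (use S(2) in \<open>auto simp: mono_def\<close>)
    then show ?thesis unfolding R_def by linarith
  qed
  moreover have "\<forall>\<^sub>F k in sequentially. continuity_index E F T k \<le> R k"
    if clo: "continuous_linear_operator E F T" for T
  proof -
    obtain a where "\<forall>\<^sub>F k in sequentially. continuity_index E F T k \<le> S a k"
      using T[OF clo] by blast
    then show ?thesis by (rule eventually_mono) (use le order_trans in blast)
  qed
  ultimately show ?thesis unfolding tame_pair_def by blast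
qed

section \<open>Finite limit points of the quotients\<close>

lemma bounded_finite_limit_points_imp:
  assumes "bounded (finite_limit_points \<beta> \<alpha>)"
  shows "\<exists>L::nat. \<forall>K. finite {(i, j). 0 < \<alpha> j \<and> real L * \<alpha> j < \<beta> i \<and> \<beta> i < K * \<alpha> j}"
proof -
  obtain B where B: "\<And>t. t \<in> finite_limit_points \<beta> \<alpha> \<Longrightarrow> \<bar>t\<bar> \<le> B"
    using assms by (auto simp: bounded_iff)
  \<comment> \<open>Being above \<open>B\<close>, the number \<open>L\<close> makes
    \<open>[L, K]\<close> free of limit points for every \<open>K\<close>. It is a natural number
    because it later enters a seminorm level.\<close>
  define L where "L = nat \<lceil>B\<rceil> + 1"
  have L: "B < real L" unfolding L_def by linarith
  have "finite {(i, j). 0 < \<alpha> j \<and> real L * \<alpha> j < \<beta> i \<and> \<beta> i < K * \<alpha> j}" for K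
  proof -
    let ?P = "\<lambda>U. {(i, j). \<alpha> j \<noteq> 0 \<and> \<beta> i / \<alpha> j \<in> U}"
    have "\<forall>t\<in>{real L..K}. \<exists>U. open U \<and> t \<in> U \<and> finite (?P U)"
    proof
      fix t assume "t \<in> {real L..K}"
      have "t \<notin> finite_limit_points \<beta> \<alpha>" using B[of t] L \<open>t \<in> _\<close> by auto
      then show "\<exists>U. open U \<and> t \<in> U \<and> finite (?P U)" unfolding finite_limit_points_def by blast
    qed
    from bchoice[OF this] obtain U
      where U: "\<forall>t\<in>{real L..K}. open (U t) \<and> t \<in> U t \<and> finite (?P (U t))" ..
    have "open (U t)" if "t \<in> {real L..K}" for t using U that by simp
    moreover have "{real L..K} \<subseteq> (\<Union>t\<in>{real L..K}. U t)" using U by fast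
    ultimately obtain D where D: "D \<subseteq> {real L..K}" "finite D" "{real L..K} \<subseteq> (\<Union>t\<in>D. U t)"
      using compactE_image[OF compact_Icc, of "{real L..K}" U] by metis
    have "{(i, j). 0 < \<alpha> j \<and> real L * \<alpha> j < \<beta> i \<and> \<beta> i < K * \<alpha> j} \<subseteq> (\<Union>t\<in>D. ?P (U t))"
    proof (clarify)
      fix i j assume a: "0 < \<alpha> j" "real L * \<alpha> j < \<beta> i" "\<beta> i < K * \<alpha> j"
      then have "\<beta> i / \<alpha> j \<in> {real L..K}" by (auto simp: field_simps)
      then show "(i, j) \<in> (\<Union>t\<in>D. ?P (U t))" using D a by auto
    qed
    then show ?thesis using D U by (meson finite_UN finite_subset subsetD)
  qed
  then show ?thesis by blast
qed

lemma finite_sublevel_at_top: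
  fixes f :: "nat \<Rightarrow> 'a::{unbounded_dense_linorder}"
  assumes "filterlim f at_top sequentially"
  shows "finite {n. f n \<le> c}"
proof -
  obtain N where "\<And>n. n \<ge> N \<Longrightarrow> c < f n"
    using assms unfolding filterlim_at_top_dense eventually_sequentially by blast
  then have "{n. f n \<le> c} \<subseteq> {..<N}" by (auto simp: not_le[symmetric])
  then show ?thesis by (rule finite_subset) simp
qed

text \<open>The infinitely many pairs near \<open>t\<close> could a priori share one index. Near
  \<open>t \<noteq> 0\<close> the quotients stay away from 0 and from infinity, so each fixed index
  admits only finitely many partners, and both indices can be taken large.\<close>

lemma finite_limit_points_pairs:
  assumes \<alpha>: "filterlim \<alpha> at_top sequentially" and \<beta>: "filterlim \<beta> at_top sequentially"
    and t: "t \<in> finite_limit_points \<beta> \<alpha>" "t \<noteq> 0" and U: "open U" "t \<in> U"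
  shows "\<exists>i>N. \<exists>j>N. 0 < \<alpha> j \<and> 0 < \<beta> i \<and> \<beta> i / \<alpha> j \<in> U"
proof -
  obtain M where M: "\<And>n. n \<ge> M \<Longrightarrow> 0 < \<alpha> n" "\<And>n. n \<ge> M \<Longrightarrow> 0 < \<beta> n"
    using filterlim_at_top_dense[THEN iffD1, OF \<alpha>, rule_format, of 0]
      filterlim_at_top_dense[THEN iffD1, OF \<beta>, rule_format, of 0]
    unfolding eventually_sequentially by (meson le_trans linorder_le_cases)
  define N' where "N' = max N M"
  \<comment> \<open>The upper bound on the quotient leaves finitely many \<open>i\<close> for each
    \<open>j\<close>, the lower bound finitely many \<open>j\<close> for each
    \<open>i\<close>.\<close>
  define V where "V = U \<inter> {s. \<bar>t\<bar> / 2 < \<bar>s\<bar>} \<inter> {s. \<bar>s\<bar> < 2 * \<bar>t\<bar>}"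
  have "open V" unfolding V_def
    by (intro open_Int U open_Collect_less continuous_intros)
  moreover have "t \<in> V" using t U by (auto simp: V_def)
  ultimately have inf: "infinite {(i, j). \<alpha> j \<noteq> 0 \<and> \<beta> i / \<alpha> j \<in> V}" (is "infinite ?P")
    using t unfolding finite_limit_points_def by blast
  have "\<exists>i>N'. \<exists>j>N'. (i, j) \<in> ?P"
  proof (rule ccontr)
    assume "\<not> ?thesis"
    then have none: "\<not> (i > N' \<and> j > N')" if "(i, j) \<in> ?P" for i j using that by blast
    have sub: "?P \<subseteq> (\<Union>j\<in>{..N'}. {i. \<beta> i \<le> 2 * \<bar>t\<bar> * \<bar>\<alpha> j\<bar>} \<times> {j})
        \<union> (\<Union>i\<in>{..N'}. {i} \<times> {j. \<alpha> j \<le> 2 / \<bar>t\<bar> * \<bar>\<beta> i\<bar>})"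
    proof (intro subsetI)
      fix p assume p: "p \<in> ?P"
      obtain i j where ij: "p = (i, j)" by fastforce
      with p have r: "\<alpha> j \<noteq> 0" "\<bar>t\<bar> / 2 < \<bar>\<beta> i\<bar> / \<bar>\<alpha> j\<bar>" "\<bar>\<beta> i\<bar> / \<bar>\<alpha> j\<bar> < 2 * \<bar>t\<bar>"
        by (auto simp: V_def)
      then have "\<beta> i \<le> 2 * \<bar>t\<bar> * \<bar>\<alpha> j\<bar>" "\<alpha> j \<le> 2 / \<bar>t\<bar> * \<bar>\<beta> i\<bar>"
        using t(2) by (auto simp: field_simps)
      moreover have "i \<le> N' \<or> j \<le> N'" using none[of i j] p unfolding ij by linarith
      ultimately show "p \<in> (\<Union>j\<in>{..N'}. {i. \<beta> i \<le> 2 * \<bar>t\<bar> * \<bar>\<alpha> j\<bar>} \<times> {j})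
        \<union> (\<Union>i\<in>{..N'}. {i} \<times> {j. \<alpha> j \<le> 2 / \<bar>t\<bar> * \<bar>\<beta> i\<bar>})"
        using ij by auto
    qed
    have "finite ?P" by (rule finite_subset[OF sub]) (auto intro!: finite_sublevel_at_top \<alpha> \<beta>)
    then show False using inf by contradiction
  qed
  then obtain i j where "i > N'" "j > N'" "\<beta> i / \<alpha> j \<in> V" by auto
  then show ?thesis using M[of i] M[of j] by (intro exI[of _ i] exI[of _ j]) (auto simp: N'_def V_def)
qed

lemma unbounded_finite_limit_points_imp:
  assumes \<alpha>: "filterlim \<alpha> at_top sequentially" and \<beta>: "filterlim \<beta> at_top sequentially"
    and ub: "\<not> bounded (finite_limit_points \<beta> \<alpha>)"
  shows "\<exists>B::nat. \<forall>N. \<exists>i>N. \<exists>j>N. 0 < \<alpha> j \<and> 0 < \<beta> i \<and> q * \<alpha> j < \<beta> i \<and> \<beta> i < real B * \<alpha> j"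
proof -
  obtain t where t: "t \<in> finite_limit_points \<beta> \<alpha>" "\<bar>t\<bar> > \<bar>q\<bar> + 1"
    using ub by (auto simp: bounded_iff not_le)
  \<comment> \<open>So far only the absolute value of \<open>t\<close> is known to be large. A
    negative \<open>t\<close> would force negative quotients between positive terms.\<close>
  have "t > 0"
  proof (rule ccontr)
    assume "\<not> t > 0"
    then obtain i j where "0 < \<alpha> j" "0 < \<beta> i" "\<beta> i / \<alpha> j < 0"
      using finite_limit_points_pairs[OF \<alpha> \<beta> t(1), of "{..<0}" 0] t(2)
      by (metis abs_zero add_nonneg_pos abs_ge_zero lessThan_iff linorder_neqE_linordered_idom
          not_less_iff_gr_or_eq open_lessThan zero_less_one)
    then show False by (simp add: divide_less_0_iff)
  qed
  then have "t \<in> {q<..<t + 1}" using t by auto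
  \<comment> \<open>The upper bound depends on \<open>t\<close> alone, so it is fixed before
    \<open>N\<close> and serves all pairs.\<close>
  moreover obtain B :: nat where "t + 1 \<le> real B" using real_arch_simple by blast
  ultimately have "\<exists>i>N. \<exists>j>N. 0 < \<alpha> j \<and> 0 < \<beta> i \<and> q * \<alpha> j < \<beta> i \<and> \<beta> i < real B * \<alpha> j" for N
  proof -
    obtain i j where "i > N" "j > N" and pos: "0 < \<alpha> j" "0 < \<beta> i"
      and r: "q < \<beta> i / \<alpha> j" "\<beta> i / \<alpha> j < t + 1"
      using finite_limit_points_pairs[OF \<alpha> \<beta> t(1), of "{q<..<t + 1}" N] \<open>t > 0\<close> \<open>t \<in> {q<..<t + 1}\<close>
      by auto
    moreover have "\<beta> i / \<alpha> j < real B" using r(2) \<open>t + 1 \<le> real B\<close> by linarith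
    then have "q * \<alpha> j < \<beta> i" "\<beta> i < real B * \<alpha> j"
      using r(1) pos(1) by (simp_all add: less_divide_eq divide_less_eq)
    ultimately show ?thesis by blast
  qed
  then show ?thesis by blast
qed

section \<open>Bounded limit points imply linear tameness\<close>

lemma bounded_finite_limit_points_imp_linearly_tame:
  fixes \<alpha> \<beta> :: "nat \<Rightarrow> real"
  defines "E \<equiv> power_series_space \<alpha> :: ('k::real_normed_field, nat \<Rightarrow> 'k) graded_space"
    and "F \<equiv> power_series_space \<beta> :: ('k, nat \<Rightarrow> 'k) graded_space"
  assumes "mono \<alpha>" and \<alpha>: "filterlim \<alpha> at_top sequentially"
    and bdd: "bounded (finite_limit_points \<beta> \<alpha>)"
  shows "linearly_tame_pair E F"
proof -
  obtain L :: nat where L: "\<And>K. finite {(i, j). 0 < \<alpha> j \<and> real L * \<alpha> j < \<beta> i \<and> \<beta> i < K * \<alpha> j}"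
    using bounded_finite_limit_points_imp[OF bdd] by blast
  have "\<forall>\<^sub>F k in sequentially. continuity_index E F T k \<le> (L + 1) * k"
    if T: "continuous_linear_operator E F T" for T
  proof -
    define y where "y j = T (\<lambda>n. if n = j then 1 else 0)" for j
    have e: "(\<lambda>n. if n = j then 1 else (0::'k)) \<in> space_of E" for j
      unfolding E_def by (rule single_in_power_series_space)
    have y_in: "y j \<in> space_of F" for j
      using continuous_linear_operatorD(1)[OF T[unfolded E_def F_def]] e
      unfolding y_def E_def F_def by blast
    then have sm: "summable (\<lambda>i. norm (y j i) * exp (real k * \<beta> i))" for j and k :: nat
      by (simp add: F_def)
    have bd: "\<exists>r C. C \<ge> 0 \<and> (\<forall>j. seminorm_of F k (y j) \<le> C * exp (real r * \<alpha> j))" for k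
    proof -
      obtain r C where "C \<ge> 0" and C: "\<And>x. x \<in> space_of E \<Longrightarrow> seminorm_of F k (T x) \<le> C * seminorm_of E r x"
        using continuous_linear_operator_bound[OF \<open>mono \<alpha>\<close>] T unfolding E_def F_def by blast
      moreover have "seminorm_of F k (y j) \<le> C * exp (real r * \<alpha> j)" for j
        using C[OF e[of j]] single_in_power_series_space(2)[of \<alpha> r j "1::'k"]
        unfolding y_def E_def by simp
      ultimately show ?thesis by blast
    qed
    \<comment> \<open>Level 0 is treated before \<open>k\<close> is chosen: its index is the
      threshold beyond which the linear bound holds.\<close>
    obtain r\<^sub>0 C\<^sub>0 where C\<^sub>0: "C\<^sub>0 \<ge> 0" "\<And>j. seminorm_of F 0 (y j) \<le> C\<^sub>0 * exp (real r\<^sub>0 * \<alpha> j)"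
      using bd by blast
    have "continuity_index E F T k \<le> (L + 1) * k" if k: "k \<ge> r\<^sub>0" for k
    proof -
      obtain K C where C: "C \<ge> 0" "\<And>j. seminorm_of F (k + 1) (y j) \<le> C * exp (real K * \<alpha> j)"
        using bd by blast
      define r where "r = (L + 1) * k"
      \<comment> \<open>The exceptional \<open>j\<close>, where \<alpha> is not positive or some
        \<open>\<beta> i\<close> falls into the gap. \<open>K\<close> depends on \<open>k\<close>,
        but \<open>X\<close> is finite for every \<open>K\<close> with the same
        \<open>L\<close>.\<close>
      define X where "X = {j. \<alpha> j \<le> 0} \<union> snd ` {(i, j). 0 < \<alpha> j \<and> real L * \<alpha> j < \<beta> i \<and> \<beta> i < real K * \<alpha> j}"
      have X: "finite X" unfolding X_def using L finite_sublevel_at_top[OF \<alpha>] by blast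
      have good: "seminorm_of F k (y j) \<le> (C\<^sub>0 + C) * exp (real r * \<alpha> j)" if j: "j \<notin> X" for j
      proof -
        have pos: "\<alpha> j > 0" using j by (auto simp: X_def)
        have gap: "\<beta> i \<le> real L * \<alpha> j \<or> real K * \<alpha> j \<le> \<beta> i" for i
          using j pos by (force simp: X_def image_iff not_less)
        define u where "u = exp (real k * real L * \<alpha> j)"
        define v where "v = exp (- (real K * \<alpha> j))"
        have uv: "u \<ge> 0" "v \<ge> 0" by (auto simp: u_def v_def)
        \<comment> \<open>Below the gap the weight is at most \<open>u\<close>, and level 0 has
          weight 1. Above it, lowering the level from \<open>k + 1\<close> to \<open>k\<close> gains
          the factor \<open>exp (- \<beta> i) \<le> v\<close>.\<close>
        have "exp (real k * \<beta> i) \<le> u * exp (real 0 * \<beta> i) + v * exp (real (k + 1) * \<beta> i)" for i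
          using gap[of i]
        proof
          assume "\<beta> i \<le> real L * \<alpha> j"
          then have "exp (real k * \<beta> i) \<le> u"
            unfolding u_def by (simp add: mult.assoc mult_left_mono)
          then show ?thesis using uv by (simp add: add_increasing2)
        next
          assume "real K * \<alpha> j \<le> \<beta> i"
          then have "exp (real k * \<beta> i) \<le> v * exp (real (k + 1) * \<beta> i)"
            unfolding v_def by (simp add: algebra_simps flip: exp_add)
          then show ?thesis using uv by (simp add: add_increasing)
        qed
        then have "norm (y j i) * exp (real k * \<beta> i)
            \<le> u * (norm (y j i) * exp (real 0 * \<beta> i)) + v * (norm (y j i) * exp (real (k + 1) * \<beta> i))" for i
          by (smt (verit) distrib_left mult.left_commute mult_left_mono norm_ge_zero)
        then have "seminorm_of F k (y j) \<le> u * seminorm_of F 0 (y j) + v * seminorm_of F (k + 1) (y j)"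
          unfolding F_def power_series_space_simps
          by (subst (1 2) suminf_mult[symmetric, OF sm], subst suminf_add)
            (intro suminf_le summable_add summable_mult sm | assumption)+
        also have "u * seminorm_of F 0 (y j) \<le> u * (C\<^sub>0 * exp (real r\<^sub>0 * \<alpha> j))"
          using C\<^sub>0 uv by (intro mult_left_mono)
        also have "\<dots> = C\<^sub>0 * exp (real k * real L * \<alpha> j + real r\<^sub>0 * \<alpha> j)"
          unfolding u_def exp_add by simp
        \<comment> \<open>Here the threshold on \<open>k\<close> enters: the index of level 0 is at
          most \<open>k\<close>, which turns slope \<open>L\<close> into
          \<open>L + 1\<close>.\<close>
        also have "\<dots> \<le> C\<^sub>0 * exp (real r * \<alpha> j)"
          using C\<^sub>0 k pos by (intro mult_left_mono) (auto simp: r_def algebra_simps)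
        also have "v * seminorm_of F (k + 1) (y j) \<le> v * (C * exp (real K * \<alpha> j))"
          using C uv by (intro mult_left_mono)
        also have "\<dots> = C" unfolding v_def by (simp add: exp_minus field_simps)
        also have "C \<le> C * exp (real r * \<alpha> j)"
          using C pos by (simp add: mult_le_cancel_left1)
        finally show ?thesis by (simp add: algebra_simps)
      qed
      \<comment> \<open>The sum enlarges the constant so that it also covers the finitely many
        exceptional \<open>j\<close>.\<close>
      define D where "D = C\<^sub>0 + C + (\<Sum>j\<in>X. seminorm_of F k (y j) / exp (real r * \<alpha> j))"
      have nn: "seminorm_of F k (y j) \<ge> 0" for j
        using y_in unfolding F_def by (rule seminorm_nonneg)
      then have sum_nn: "(\<Sum>j\<in>X. seminorm_of F k (y j) / exp (real r * \<alpha> j)) \<ge> 0"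
        by (intro sum_nonneg) simp
      have "seminorm_of F k (y j) \<le> D * exp (real r * \<alpha> j)" for j
      proof (cases "j \<in> X")
        case True
        then have "seminorm_of F k (y j) / exp (real r * \<alpha> j) \<le> D"
          using member_le_sum[OF True, of "\<lambda>j. seminorm_of F k (y j) / exp (real r * \<alpha> j)"] X nn C\<^sub>0 C
          unfolding D_def by simp
        then show ?thesis by (simp add: field_simps)
      next
        case False
        have "(C\<^sub>0 + C) * exp (real r * \<alpha> j) \<le> D * exp (real r * \<alpha> j)"
          using sum_nn unfolding D_def by (intro mult_right_mono) auto
        then show ?thesis using good[OF False] by linarith
      qed
      moreover have "D \<ge> 0" using sum_nn C\<^sub>0 C unfolding D_def by simp
      ultimately show ?thesis
        using continuity_index_le[OF \<open>mono \<alpha>\<close>, where T = T and \<beta> = \<beta> and r = r] T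
        unfolding y_def E_def F_def r_def by blast
    qed
    then show ?thesis by (auto simp: eventually_sequentially)
  qed
  moreover have "mono (\<lambda>k. (L + 1) * k)" by (intro monoI mult_left_mono) auto
  moreover have "mono (\<lambda>a::nat. (L + 1) * k) \<and> (\<lambda>a::nat. real ((L + 1) * k)) \<longlonglongrightarrow> (real L + 1) * real k + 0" for k
    by (simp add: mono_def algebra_simps)
  ultimately show ?thesis
    unfolding linearly_tame_pair_def
    \<comment> \<open>One function serves all operators, so the family is constant in
      \<open>a\<close> and its convergence is trivial.\<close>
    by (intro exI[of _ "\<lambda>_ k. (L + 1) * k"] exI[of _ "real L + 1"] exI[of _ 0]) blast
qed

section \<open>Tameness implies bounded limit points\<close>

text \<open>For injective \<open>I\<close> and \<open>J\<close> this sends the unit vector at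
  \<open>J n\<close> to \<open>c n\<close> times the one at \<open>I n\<close> and kills the others.
  The coordinatewise form makes it linear on all sequences, with no convergence to check.\<close>

definition weighted_transfer ::
  "(nat \<Rightarrow> nat) \<Rightarrow> (nat \<Rightarrow> nat) \<Rightarrow> (nat \<Rightarrow> real) \<Rightarrow> (nat \<Rightarrow> 'k::real_normed_field) \<Rightarrow> nat \<Rightarrow> 'k" where
  "weighted_transfer I J c x i =
    (if i \<in> range I then of_real (c (inv I i)) * x (J (inv I i)) else 0)"

lemma weighted_transfer_single:
  assumes "inj I" "inj J"
  shows "weighted_transfer I J c (\<lambda>n. if n = J m then a else 0)
    = (\<lambda>i. if i = I m then of_real (c m) * a else 0)"
  using assms by (auto simp: weighted_transfer_def fun_eq_iff inj_eq)

text \<open>The image is supported on the range of \<open>I\<close>, so its series can be reindexed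
  by \<open>n\<close>. There it is dominated termwise by the subseries of \<open>x\<close> along
  \<open>J\<close>.\<close>

lemma weighted_transfer_bound:
  fixes x :: "nat \<Rightarrow> 'k::real_normed_field"
  assumes "strict_mono I" "strict_mono J" "\<And>n. c n \<ge> 0"
    and bd: "\<And>n. c n * exp (real k * \<beta> (I n)) \<le> exp (real r * \<alpha> (J n))"
    and x: "summable (\<lambda>n. norm (x n) * exp (real r * \<alpha> n))"
  shows "summable (\<lambda>i. norm (weighted_transfer I J c x i) * exp (real k * \<beta> i))"
    and "(\<Sum>i. norm (weighted_transfer I J c x i) * exp (real k * \<beta> i))
      \<le> (\<Sum>n. norm (x n) * exp (real r * \<alpha> n))"
proof -
  let ?f = "\<lambda>i. norm (weighted_transfer I J c x i) * exp (real k * \<beta> i)"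
  let ?g = "\<lambda>n. norm (x n) * exp (real r * \<alpha> n)"
  have inj: "inj I" "inj J" using assms(1,2) by (auto intro: strict_mono_imp_inj_on)
  have f0: "?f i = 0" if "i \<notin> range I" for i using that by (simp add: weighted_transfer_def)
  have f: "?f (I n) \<le> ?g (J n)" for n
    using mult_left_mono[OF bd[of n] norm_ge_zero[of "x (J n)"]] assms(3)[of n] inj
    by (simp add: weighted_transfer_def norm_mult mult_ac)
  have gJ: "summable (\<lambda>n. ?g (J n))" "(\<Sum>n. ?g (J n)) \<le> suminf ?g"
    using summable_reindex[OF x inj(2)] suminf_reindex_mono[OF x inj(2)] by (simp_all add: o_def)
  have fI: "summable (\<lambda>n. ?f (I n))"
    by (rule summable_comparison_test'[OF gJ(1), of 0]) (use f in auto)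
  then show "summable ?f"
    using summable_mono_reindex[OF assms(1), of ?f] f0 by blast
  have "suminf ?f = (\<Sum>n. ?f (I n))"
    using suminf_mono_reindex[OF assms(1), of ?f] f0 by simp
  also have "\<dots> \<le> (\<Sum>n. ?g (J n))" by (rule suminf_le[OF f fI gJ(1)])
  finally show "suminf ?f \<le> suminf ?g" using gJ(2) by linarith
qed

lemma tame_pair_imp_bounded_finite_limit_points:
  fixes \<alpha> \<beta> :: "nat \<Rightarrow> real"
  defines "E \<equiv> power_series_space \<alpha> :: ('k::real_normed_field, nat \<Rightarrow> 'k) graded_space"
    and "F \<equiv> power_series_space \<beta> :: ('k, nat \<Rightarrow> 'k) graded_space"
  assumes \<alpha>: "filterlim \<alpha> at_top sequentially" and \<beta>: "filterlim \<beta> at_top sequentially"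
    and tame: "tame_pair E F"
  shows "bounded (finite_limit_points \<beta> \<alpha>)"
proof (rule ccontr)
  assume ub: "\<not> bounded (finite_limit_points \<beta> \<alpha>)"
  obtain S :: "nat \<Rightarrow> nat" where
    S: "\<And>T. continuous_linear_operator E F T \<Longrightarrow> \<forall>\<^sub>F k in sequentially. continuity_index E F T k \<le> S k"
    using tame unfolding tame_pair_def by blast
  \<comment> \<open>\<open>B\<close> precedes \<open>N\<close>: continuity needs one upper bound for
    the whole \<open>m\<close>-th family. The summand 1 next to \<open>S (m + 1)\<close> leaves a
    surplus of one \<open>\<alpha> j\<close> in the final exponent.\<close>
  have "\<forall>m. \<exists>B::nat. \<forall>N. \<exists>i>N. \<exists>j>N. 0 < \<alpha> j \<and> 0 < \<beta> i \<and>
      real (S (m + 1) + 1) * \<alpha> j < \<beta> i \<and> \<beta> i < real B * \<alpha> j"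
    using unbounded_finite_limit_points_imp[OF \<alpha> \<beta> ub] by blast
  then obtain B :: "nat \<Rightarrow> nat" where B: "\<And>m N. \<exists>i>N. \<exists>j>N. 0 < \<alpha> j \<and> 0 < \<beta> i \<and>
      real (S (m + 1) + 1) * \<alpha> j < \<beta> i \<and> \<beta> i < real (B m) * \<alpha> j"
    by metis
  \<comment> \<open>\<open>\<mu> n\<close> is the family of the \<open>n\<close>-th pair; every family occurs infinitely often.\<close>
  define \<mu> where "\<mu> n = fst (prod_decode n)" for n
  define P where "P n p \<longleftrightarrow> 0 < \<alpha> (snd p) \<and> 0 < \<beta> (fst p) \<and>
      real (S (\<mu> n + 1) + 1) * \<alpha> (snd p) < \<beta> (fst p) \<and> \<beta> (fst p) < real (B (\<mu> n)) * \<alpha> (snd p)" for n p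
  have P: "\<exists>p. P n p \<and> N < fst p \<and> N < snd p" for n N
    using B[of N "\<mu> n"] unfolding P_def by force
  have "\<exists>f. \<forall>n. P n (f n) \<and> fst (f n) < fst (f (Suc n)) \<and> snd (f n) < snd (f (Suc n))"
  proof (rule dependent_nat_choice)
    show "\<exists>p. P 0 p" using P by blast
    show "\<exists>q. P (Suc n) q \<and> fst p < fst q \<and> snd p < snd q" for p n
      using P[of "Suc n" "max (fst p) (snd p)"] by auto
  qed
  then obtain f where f: "\<And>n. P n (f n)"
    "\<And>n. fst (f n) < fst (f (Suc n))" "\<And>n. snd (f n) < snd (f (Suc n))" by blast
  define I where "I n = fst (f n)" for n
  define J where "J n = snd (f n)" for n
  have mono: "strict_mono I" "strict_mono J"
    using f by (auto simp: strict_mono_Suc_iff I_def J_def)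
  then have inj: "inj I" "inj J" by (auto intro: strict_mono_imp_inj_on)
  have IJ: "0 < \<alpha> (J n)" "0 < \<beta> (I n)" "real (S (\<mu> n + 1) + 1) * \<alpha> (J n) < \<beta> (I n)"
    "\<beta> (I n) < real (B (\<mu> n)) * \<alpha> (J n)" for n
    using f(1)[of n] unfolding P_def I_def J_def by blast+
  define c where "c n = exp (- (real (\<mu> n) * \<beta> (I n)))" for n
  define T :: "(nat \<Rightarrow> 'k) \<Rightarrow> nat \<Rightarrow> 'k" where "T = weighted_transfer I J c"
  have "\<exists>r. \<forall>n. c n * exp (real k * \<beta> (I n)) \<le> exp (real r * \<alpha> (J n))" for k
  proof -
    \<comment> \<open>Only the finitely many families below \<open>k\<close> give a positive
      exponent, and the sum bounds all their \<open>B m\<close> at once.\<close>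
    define r where "r = k * (\<Sum>m<k. B m)"
    have "(real k - real (\<mu> n)) * \<beta> (I n) \<le> real r * \<alpha> (J n)" for n
    proof (cases "\<mu> n < k")
      case True
      then have "B (\<mu> n) \<le> (\<Sum>m<k. B m)" by (intro member_le_sum) auto
      then have "real (B (\<mu> n)) * \<alpha> (J n) \<le> real (\<Sum>m<k. B m) * \<alpha> (J n)"
        using IJ(1)[of n] by (intro mult_right_mono) (auto simp del: of_nat_sum)
      then have "\<beta> (I n) \<le> real (\<Sum>m<k. B m) * \<alpha> (J n)" using IJ(4)[of n] by linarith
      then have "real k * \<beta> (I n) \<le> real r * \<alpha> (J n)"
        unfolding r_def of_nat_mult mult.assoc by (intro mult_left_mono) auto
      moreover have "(real k - real (\<mu> n)) * \<beta> (I n) \<le> real k * \<beta> (I n)"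
        using IJ(2)[of n] by (intro mult_right_mono) auto
      ultimately show ?thesis by linarith
    next
      case False
      then have "(real k - real (\<mu> n)) * \<beta> (I n) \<le> 0"
        using IJ(2)[of n] by (intro mult_nonpos_nonneg) auto
      moreover have "0 \<le> real r * \<alpha> (J n)" using IJ(1)[of n] by simp
      ultimately show ?thesis by linarith
    qed
    then show ?thesis unfolding c_def by (auto simp: algebra_simps simp flip: exp_add)
  qed
  then obtain R where R: "\<And>k n. c n * exp (real k * \<beta> (I n)) \<le> exp (real (R k) * \<alpha> (J n))"
    by metis
  have c0: "c n \<ge> 0" for n by (simp add: c_def)
  have bounds: "summable (\<lambda>i. norm (T x i) * exp (real k * \<beta> i))"
    "seminorm_of F k (T x) \<le> seminorm_of E (R k) x" if x: "x \<in> space_of E" for x k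
  proof -
    have "summable (\<lambda>n. norm (x n) * exp (real (R k) * \<alpha> n))" using x by (simp add: E_def)
    note weighted_transfer_bound[where c = c, OF mono c0 R[of _ k] this]
    then show "summable (\<lambda>i. norm (T x i) * exp (real k * \<beta> i))"
      "seminorm_of F k (T x) \<le> seminorm_of E (R k) x"
      unfolding T_def E_def F_def by simp_all
  qed
  then have T_in: "T x \<in> space_of F" if "x \<in> space_of E" for x
    using that by (simp add: F_def)
  note T_le = bounds(2)
  have clo: "continuous_linear_operator E F T"
    unfolding E_def F_def
  proof (rule continuous_linear_operatorI)
    show "\<exists>r C. \<forall>x\<in>space_of (power_series_space \<alpha>).
        seminorm_of (power_series_space \<beta>) k (T x) \<le> C * seminorm_of (power_series_space \<alpha>) r x" for k
      using T_le[of _ k] unfolding E_def F_def by (metis mult_1)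
  qed (use T_in in \<open>auto simp: E_def F_def T_def weighted_transfer_def fun_eq_iff algebra_simps\<close>)
  obtain m where m: "continuity_index E F T (m + 1) \<le> S (m + 1)"
    using S[OF clo] unfolding eventually_sequentially by (metis le_add1)
  let ?bdd = "\<lambda>r. bdd_above ((\<lambda>x. seminorm_of F (m + 1) (T x)) ` {x \<in> space_of E. seminorm_of E r x \<le> 1})"
  define r where "r = continuity_index E F T (m + 1)"
  \<comment> \<open>Some level is admissible, so the infimum is attained and is not the default
    value of \<open>Inf {}\<close>.\<close>
  have "?bdd (R (m + 1))"
    using T_le[of _ "m + 1"] by (intro bdd_aboveI[of _ 1]) (force intro: order_trans)
  then have "Collect ?bdd \<noteq> {}" by fast
  then have "Inf (Collect ?bdd) \<in> Collect ?bdd" by (rule Inf_nat_def1)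
  then have "?bdd r" unfolding r_def continuity_index_def by (rule CollectD)
  then obtain D where D: "\<And>x. x \<in> space_of E \<Longrightarrow> seminorm_of E r x \<le> 1 \<Longrightarrow> seminorm_of F (m + 1) (T x) \<le> D"
    by (auto simp: bdd_above_def)
  have "\<alpha> (J n) \<le> D" if n: "\<mu> n = m" for n
  proof -
    \<comment> \<open>The factor normalises the unit vector at \<open>J n\<close> to seminorm 1 at
      level \<open>r\<close>.\<close>
    define a where "a = exp (- (real r * \<alpha> (J n)))"
    define x where "x = (\<lambda>i. if i = J n then of_real a else (0::'k))"
    have "seminorm_of E r x = 1" "x \<in> space_of E"
      using single_in_power_series_space(2)[of \<alpha> r "J n" "of_real a :: 'k"]
        single_in_power_series_space(1)[of "J n" "of_real a :: 'k" \<alpha>]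
      unfolding x_def E_def by (auto simp: a_def simp flip: exp_add)
    moreover have "T x = (\<lambda>i. if i = I n then of_real (c n) * of_real a else 0)"
      unfolding T_def x_def by (rule weighted_transfer_single[OF inj])
    then have "seminorm_of F (m + 1) (T x) = c n * a * exp (real (m + 1) * \<beta> (I n))"
      using single_in_power_series_space(2)[of \<beta> "m + 1" "I n" "of_real (c n) * of_real a :: 'k"]
      unfolding F_def by (simp add: norm_mult a_def c_def del: power_series_space_simps)
    ultimately have "c n * a * exp (real (m + 1) * \<beta> (I n)) \<le> D"
      using D[of x] by simp
    \<comment> \<open>The weight \<open>c n\<close> cancels \<open>m\<close> of the
      \<open>m + 1\<close> multiples of \<open>\<beta> (I n)\<close>.\<close>
    then have "exp (\<beta> (I n) - real r * \<alpha> (J n)) \<le> D"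
      unfolding c_def a_def n by (simp add: algebra_simps flip: exp_add)
    moreover have "\<alpha> (J n) \<le> \<beta> (I n) - real r * \<alpha> (J n)"
    proof -
      have "real (r + 1) * \<alpha> (J n) \<le> real (S (m + 1) + 1) * \<alpha> (J n)"
        using m IJ(1)[of n] unfolding r_def by (intro mult_right_mono) auto
      then show ?thesis using IJ(3)[of n] n by (simp add: algebra_simps)
    qed
    ultimately show ?thesis using exp_ge_add_one_self[of "\<beta> (I n) - real r * \<alpha> (J n)"] by linarith
  qed
  moreover have "filterlim (\<lambda>n. \<alpha> (J n)) at_top sequentially"
    using filterlim_compose[OF \<alpha> filterlim_subseq[OF mono(2)]] .
  then obtain N where "\<And>n. n \<ge> N \<Longrightarrow> D < \<alpha> (J n)"
    unfolding filterlim_at_top_dense eventually_sequentially by blast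
  \<comment> \<open>The family \<open>m\<close> has members beyond any \<open>N\<close>, where
    \<alpha> exceeds \<open>D\<close>; this contradicts the bound just proved.\<close>
  moreover have "\<mu> (prod_encode (m, N)) = m" "prod_encode (m, N) \<ge> N"
    by (simp_all add: \<mu>_def le_prod_encode_2)
  ultimately show False by (meson not_less)
qed

theorem theorem4p6:
  fixes \<alpha> \<beta> :: "nat \<Rightarrow> real"
    and E F :: "('k :: real_normed_field, nat \<Rightarrow> 'k) graded_space"
  defines "E \<equiv> power_series_space \<alpha>"
    and "F \<equiv> power_series_space \<beta>"
  assumes "mono \<alpha>" and "filterlim \<alpha> at_top sequentially"
    and "mono \<beta>" and "filterlim \<beta> at_top sequentially"
  shows "(tame_pair E F \<longleftrightarrow> linearly_tame_pair E F) \<and>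
         (linearly_tame_pair E F \<longleftrightarrow> bounded (finite_limit_points \<beta> \<alpha>))"
proof -
  have "bounded (finite_limit_points \<beta> \<alpha>) \<Longrightarrow> linearly_tame_pair E F"
    using bounded_finite_limit_points_imp_linearly_tame[OF assms(3,4)] unfolding E_def F_def .
  moreover have "tame_pair E F \<Longrightarrow> bounded (finite_limit_points \<beta> \<alpha>)"
    using tame_pair_imp_bounded_finite_limit_points[OF assms(4,6)] unfolding E_def F_def .
  ultimately show ?thesis using linearly_tame_imp_tame_pair by blast
qed

end
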